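(* Let $k$ be a field of characteristic $p=2$. Any exponential matrix of $\mathrm{Mat}(4,k[T])$ is equivalent to one of the following exponential matrices (1), (2), (3), (4): (1) $\begin{pmatrix}1&a&b&c\\0&1&0&0\\0&0&1&0\\0&0&0&1\end{pmatrix}$, where $a,b,c$ are $p$-polynomials. (2) $\begin{pmatrix}1&0&a&b\\0&1&c&d\\0&0&1&0\\0&0&0&1\end{pmatrix}$, where $a,b,c,d$ are $p$-polynomials. (3) $\begin{pmatrix}1&0&0&a\\0&1&0&b\\0&0&1&c\\0&0&0&1\end{pmatrix}$, where $a,b,c$ are $p$-polynomials. (4) $\begin{pmatrix}1&a&b&\mu ab+c\\0&1&0&\mu b\\0&0&1&\mu a\\0&0&0&1\end{pmatrix}$, where $a,b,c$ are $p$-polynomials, $a,b$ are linearly independent over $k$, and $\mu\in k$.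
   Context: $k[T]$ is the polynomial ring in one variable over $k$. A matrix $A(T)\in\mathrm{Mat}(n,k[T])$ is exponential if $A(0)=I_n$ and $A(T)A(T')=A(T+T')$, where $T,T'$ are indeterminates over $k$. Two matrices $A(T),B(T)\in\mathrm{Mat}(n,k[T])$ are equivalent if $P^{-1}A(T)P=B(T)$ for some $P\in GL(n,k)$. A $p$-polynomial is a polynomial of the form $\sum_{i\ge0}c_iT^{p^i}\in k[T]$ with $c_i\in k$. *)

theory Defs
  imports
    "Jordan_Normal_Form.Matrix"
    "HOL-Computational_Algebra.Computational_Algebra"
begin

text \<open>The ring \<open>k[T, T']\<close> is rendered as \<^typ>\<open>'a poly poly\<close>: \<open>T\<close> is the inner and
  \<open>T'\<close> the outer indeterminate.\<close>

definition var_T :: "'a::field poly poly" where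
  "var_T = [:[:0, 1:]:]"

definition var_T' :: "'a::field poly poly" where
  "var_T' = [:0, 1:]"

definition subst_poly :: "'a::field poly poly \<Rightarrow> 'a poly \<Rightarrow> 'a poly poly" where
  "subst_poly q f = poly (map_poly (\<lambda>c. [:[:c:]:]) f) q"

definition subst_mat :: "'a::field poly poly \<Rightarrow> 'a poly mat \<Rightarrow> 'a poly poly mat" where
  "subst_mat q A = map_mat (subst_poly q) A"

definition exponential_mat :: "nat \<Rightarrow> 'a::field poly mat \<Rightarrow> bool" where
  "exponential_mat n A \<longleftrightarrow>
     A \<in> carrier_mat n n \<and>
     map_mat (\<lambda>f. poly f 0) A = 1\<^sub>m n \<and>
     subst_mat var_T A * subst_mat var_T' A = subst_mat (var_T + var_T') A"

text \<open>\<open>Q\<close> is the inverse of \<open>P\<close>; both have entries in \<open>k\<close> and are embedded as constant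
  polynomial matrices.\<close>

definition equivalent_mat :: "nat \<Rightarrow> 'a::field poly mat \<Rightarrow> 'a poly mat \<Rightarrow> bool" where
  "equivalent_mat n A B \<longleftrightarrow>
     (\<exists>P \<in> carrier_mat n n. \<exists>Q \<in> carrier_mat n n.
        inverts_mat P Q \<and> inverts_mat Q P \<and>
        map_mat (\<lambda>c. [:c:]) Q * A * map_mat (\<lambda>c. [:c:]) P = B)"

definition p_polynomial :: "nat \<Rightarrow> 'a::field poly \<Rightarrow> bool" where
  "p_polynomial p f \<longleftrightarrow> (\<exists>m c. f = (\<Sum>i<m. monom (c i) (p ^ i)))"

text \<open>Independence of the family \<open>(a, b)\<close>, so that \<open>a = b\<close> counts as dependent.\<close>

definition lin_indep_pair :: "'a::field poly \<Rightarrow> 'a poly \<Rightarrow> bool" where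
  "lin_indep_pair a b \<longleftrightarrow> (\<forall>x y. smult x a + smult y b = 0 \<longrightarrow> x = 0 \<and> y = 0)"

definition form1 :: "nat \<Rightarrow> 'a::field poly mat set" where
  "form1 p = {mat_of_rows_list 4
      [[1, a, b, c],
       [0, 1, 0, 0],
       [0, 0, 1, 0],
       [0, 0, 0, 1]] | a b c.
     p_polynomial p a \<and> p_polynomial p b \<and> p_polynomial p c}"

definition form2 :: "nat \<Rightarrow> 'a::field poly mat set" where
  "form2 p = {mat_of_rows_list 4
      [[1, 0, a, b],
       [0, 1, c, d],
       [0, 0, 1, 0],
       [0, 0, 0, 1]] | a b c d.
     p_polynomial p a \<and> p_polynomial p b \<and> p_polynomial p c \<and> p_polynomial p d}"

definition form3 :: "nat \<Rightarrow> 'a::field poly mat set" where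
  "form3 p = {mat_of_rows_list 4
      [[1, 0, 0, a],
       [0, 1, 0, b],
       [0, 0, 1, c],
       [0, 0, 0, 1]] | a b c.
     p_polynomial p a \<and> p_polynomial p b \<and> p_polynomial p c}"

definition form4 :: "nat \<Rightarrow> 'a::field poly mat set" where
  "form4 p = {mat_of_rows_list 4
      [[1, a, b, smult \<mu> (a * b) + c],
       [0, 1, 0, smult \<mu> b],
       [0, 0, 1, smult \<mu> a],
       [0, 0, 0, 1]] | a b c \<mu>.
     p_polynomial p a \<and> p_polynomial p b \<and> p_polynomial p c \<and> lin_indep_pair a b}"

end

theory Submission
  imports Defs "HOL-Algebra.Exponent" "Jordan_Normal_Form.Determinant"
begin

text \<open>
  Write \<open>A(T) = \<Sum>\<^sub>l A\<^sub>l T\<^sup>l\<close>. Then \<open>A\<close> is exponential iff \<open>A\<^sub>0 = 1\<close> and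
  \<open>A\<^sub>l A\<^sub>m = (l + m choose l) A\<^bsub>l+m\<^esub>\<close>; hence the \<open>A\<^sub>l\<close> commute and, in characteristic 2,
  \<open>A\<^sub>l\<close> has square zero for \<open>l > 0\<close> because \<open>2l choose l\<close> is even.
  If all products \<open>A\<^sub>l A\<^sub>m\<close> with \<open>l, m > 0\<close> vanish, the common image of these \<open>A\<^sub>l\<close> lies in their
  common kernel; in a basis extending one of the image, of dimension \<open>r\<close>, the matrix is of the
  form (1), (2) or (3) according to \<open>r\<close>. Otherwise some \<open>X = A\<^sub>i\<close>, \<open>Y = A\<^sub>j\<close>, \<open>v\<close> satisfy
  \<open>X Y v \<noteq> 0\<close>, so that \<open>k\<^sup>4\<close> is a free module of rank one over \<open>k[X, Y]/(X\<^sup>2, Y\<^sup>2)\<close>. Whatever commutes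
  with \<open>X\<close> and \<open>Y\<close> is a combination of \<open>1, X, Y, X Y\<close>, and form (4) with \<open>\<mu> = 1\<close> results.
\<close>

section \<open>Substitution and additive polynomials\<close>

lemma subst_poly_pCons:
  "subst_poly q (pCons c f) = [:[:c:]:] + q * subst_poly q f"
  by (simp add: subst_poly_def map_poly_pCons)

lemma subst_poly_0 [simp]: "subst_poly q 0 = 0"
  by (simp add: subst_poly_def)

lemma subst_poly_const [simp]: "subst_poly q [:c:] = [:[:c:]:]"
  by (simp add: subst_poly_pCons)

lemma subst_poly_1 [simp]: "subst_poly q 1 = 1"
  by (simp add: one_pCons)

lemma subst_poly_add: "subst_poly q (f + g) = subst_poly q f + subst_poly q g"
  by (induction f g rule: poly_induct2) (simp_all add: subst_poly_pCons algebra_simps)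

lemma subst_poly_smult: "subst_poly q (smult c f) = [:[:c:]:] * subst_poly q f"
  by (induction f) (simp_all add: subst_poly_pCons algebra_simps)

lemma subst_poly_mult: "subst_poly q (f * g) = subst_poly q f * subst_poly q g"
  by (induction f) (simp_all add: subst_poly_pCons subst_poly_add subst_poly_smult algebra_simps)

lemma subst_poly_sum: "subst_poly q (sum f I) = (\<Sum>i\<in>I. subst_poly q (f i))"
  by (induction I rule: infinite_finite_induct) (simp_all add: subst_poly_add)

lemma subst_poly_monom: "subst_poly q (monom c m) = [:[:c:]:] * q ^ m"
  by (induction m) (simp_all add: monom_Suc subst_poly_pCons monom_0)

lemma subst_poly_T: "subst_poly var_T f = [:f:]"
  by (induction f) (simp_all add: subst_poly_pCons var_T_def)

lemma coeff_subst_poly_T': "coeff (subst_poly var_T' f) n = [:coeff f n:]"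
  by (induction f arbitrary: n)
    (simp_all add: subst_poly_pCons var_T'_def coeff_pCons split: nat.split)

text \<open>The outer index \<open>n\<close> is the exponent of T' and the inner index
  \<open>m\<close> that of T. Multiplication by T + T' adds two neighbouring coefficients, so the
  induction along \<open>pCons\<close> is Pascal's rule.\<close>

lemma coeff_subst_poly_T_plus_T':
  "coeff (coeff (subst_poly (var_T + var_T') f) n) m
     = of_nat ((m + n) choose m) * coeff f (m + n)"
proof (induction f arbitrary: m n)
  case (pCons c f)
  have q: "coeff (coeff ((var_T + var_T') * g) n) m =
    (case m of 0 \<Rightarrow> 0 | Suc m' \<Rightarrow> coeff (coeff g n) m') +
    (case n of 0 \<Rightarrow> 0 | Suc n' \<Rightarrow> coeff (coeff g n') m)" for g :: "'a poly poly" and m n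
    by (simp add: var_T_def var_T'_def distrib_right coeff_pCons split: nat.split)
  show ?case
    unfolding subst_poly_pCons coeff_add q pCons.IH
    by (cases m; cases n) (simp_all add: coeff_pCons algebra_simps)
qed simp

lemma coeff_subst_poly_T_mult_T':
  "coeff (coeff (subst_poly var_T f * subst_poly var_T' g) n) m = coeff f m * coeff g n"
  by (simp add: subst_poly_T coeff_subst_poly_T' mult.commute)

section \<open>Additive polynomials and p-polynomials\<close>

definition additive_poly :: "'a::field poly \<Rightarrow> bool" where
  "additive_poly f \<longleftrightarrow>
     subst_poly (var_T + var_T') f = subst_poly var_T f + subst_poly var_T' f"

lemma additive_poly_coeff:
  assumes "additive_poly (f :: 'a::field poly)"
  shows "coeff f 0 = 0"
    and "m > 0 \<Longrightarrow> n > 0 \<Longrightarrow> of_nat ((m + n) choose m) * coeff f (m + n) = 0"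
proof -
  have e: "of_nat ((m + n) choose m) * coeff f (m + n)
      = (if n = 0 then coeff f m else 0) + (if m = 0 then coeff f n else 0)" for m n
  proof -
    have "coeff (coeff (subst_poly (var_T + var_T') f) n) m
        = coeff (coeff (subst_poly var_T f + subst_poly var_T' f) n) m"
      using assms by (simp add: additive_poly_def)
    then show ?thesis
      by (simp only: coeff_subst_poly_T_plus_T' coeff_add subst_poly_T coeff_subst_poly_T')
        (auto simp: coeff_pCons split: nat.split)
  qed
  \<comment> \<open>At m = n = 0 the identity reads x = x + x.\<close>
  show "coeff f 0 = 0"
    using e[of 0 0] add_left_imp_eq[of 1 "1 :: 'a" 0] by auto
  show "of_nat ((m + n) choose m) * coeff f (m + n) = 0" if "m > 0" "n > 0"
    using e[of m n] that by simp
qed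

text \<open>If l is not a power of p, some binomial (l choose m) with 0 < m < l is prime to p, and
  comparing coefficients of T^m T'^(l-m) kills the coefficient at l. The converse is additivity of
  the Frobenius map.\<close>

lemma additive_poly_iff_p_polynomial:
  assumes p: "prime p" and char: "CHAR('a::field) = p"
  shows "additive_poly (f :: 'a poly) \<longleftrightarrow> p_polynomial p f"
proof
  assume add: "additive_poly f"
  have zero: "coeff f l = 0" if l: "l \<notin> range (\<lambda>i. p ^ i)" for l
  proof (cases "l = 0")
    case True
    then show ?thesis
      using additive_poly_coeff(1)[OF add] by simp
  next
    case False
    obtain k r where kr: "l = p ^ k * r" "\<not> p dvd r"
      using multiplicity_decompose'[of l p] False p
      by (metis not_prime_unit)
    have r: "r \<noteq> 1" "r > 0"
      using kr(1) l False by (force, auto intro: Nat.gr0I)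
    \<comment> \<open>The choice m = p^k works because (p^k r choose p^k) has the same p-adic
      valuation as r, which is zero.\<close>
    have "multiplicity p (p ^ k * r choose p ^ k) = 0"
      using const_p_fac[of r p k] p r kr(2) by (simp add: not_dvd_imp_multiplicity_0)
    moreover have "p ^ k * r choose p ^ k \<noteq> 0"
      using r by (simp add: binomial_eq_0_iff)
    ultimately have "\<not> p dvd (p ^ k * r choose p ^ k)"
      using p multiplicity_eq_zero_iff not_prime_unit by blast
    then have "of_nat (l choose p ^ k) \<noteq> (0 :: 'a)"
      using kr char by (simp add: of_nat_eq_0_iff_char_dvd)
    moreover have "p ^ k > 0" "p ^ k < l"
      using p r kr(1) by (auto simp: prime_gt_0_nat)
    ultimately show ?thesis
      using additive_poly_coeff(2)[OF add, of "p ^ k" "l - p ^ k"] by simp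
  qed
  have inj: "inj (\<lambda>i. p ^ i)"
    using prime_gt_1_nat[OF p] by (auto intro: injI)
  \<comment> \<open>Since k < p^k, the powers p^k with k > \<open>degree f\<close> lie beyond the
    degree, so this bound misses no nonzero coefficient.\<close>
  have "f = (\<Sum>i<Suc (degree f). monom (coeff f (p ^ i)) (p ^ i))"
  proof (rule poly_eqI)
    fix l
    show "coeff f l = coeff (\<Sum>i<Suc (degree f). monom (coeff f (p ^ i)) (p ^ i)) l"
    proof (cases "l \<in> range (\<lambda>i. p ^ i)")
      case True
      then obtain k where k: "l = p ^ k" by auto
      have "k < p ^ k"
        using prime_gt_1_nat[OF p] by (simp add: power_gt_expt)
      then have "coeff f (p ^ k) = 0" if "\<not> k < Suc (degree f)"
        using that by (intro coeff_eq_0) simp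
      then show ?thesis
        using inj prime_gt_1_nat[OF p] by (auto simp: coeff_sum k sum.delta)
    next
      case False
      then show ?thesis
        using zero by (auto simp: coeff_sum intro!: sum.neutral)
    qed
  qed
  then show "p_polynomial p f"
    unfolding p_polynomial_def by (intro exI)
next
  assume "p_polynomial p f"
  then obtain m c where f: "f = (\<Sum>i<m. monom (c i) (p ^ i))"
    unfolding p_polynomial_def by blast
  have "(var_T + var_T' :: 'a poly poly) ^ p ^ i = var_T ^ p ^ i + var_T' ^ p ^ i" for i
    by (rule freshmans_dream') (use p char in simp_all)
  then show "additive_poly f"
    by (simp add: additive_poly_def f subst_poly_sum subst_poly_monom algebra_simps
        sum.distrib)
qed

section \<open>Coefficient matrices\<close>

definition coeff_mat :: "'a::zero poly mat \<Rightarrow> nat \<Rightarrow> 'a mat" where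
  "coeff_mat A m = map_mat (\<lambda>f. coeff f m) A"

lemma coeff_mat_carrier [simp]: "A \<in> carrier_mat r c \<Longrightarrow> coeff_mat A m \<in> carrier_mat r c"
  by (simp add: coeff_mat_def)

lemma dim_coeff_mat [simp]:
  "dim_row (coeff_mat A m) = dim_row A" "dim_col (coeff_mat A m) = dim_col A"
  by (simp_all add: coeff_mat_def)

lemma coeff_mat_index [simp]:
  "i < dim_row A \<Longrightarrow> j < dim_col A \<Longrightarrow> coeff_mat A m $$ (i, j) = coeff (A $$ (i, j)) m"
  by (simp add: coeff_mat_def)

lemma mat_mult_index:
  "A \<in> carrier_mat r n \<Longrightarrow> B \<in> carrier_mat n c \<Longrightarrow> i < r \<Longrightarrow> j < c \<Longrightarrow>
    (A * B) $$ (i, j) = (\<Sum>k<n. A $$ (i, k) * B $$ (k, j))"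
  by (auto simp: scalar_prod_def atLeast0LessThan intro!: sum.cong)

lemma mat_eq_iff:
  assumes "A \<in> carrier_mat r c" "B \<in> carrier_mat r c"
  shows "A = B \<longleftrightarrow> (\<forall>i<r. \<forall>j<c. A $$ (i, j) = B $$ (i, j))"
  using assms by (auto intro!: eq_matI)

lemma exponential_mat_iff_entries:
  assumes A: "A \<in> carrier_mat n n"
  shows "exponential_mat n A \<longleftrightarrow>
    (\<forall>i<n. \<forall>j<n. coeff (A $$ (i, j)) 0 = (if i = j then 1 else 0) \<and>
      (\<Sum>k<n. subst_poly var_T (A $$ (i, k)) * subst_poly var_T' (A $$ (k, j)))
        = subst_poly (var_T + var_T') (A $$ (i, j)))"
proof -
  have c: "subst_mat q A \<in> carrier_mat n n" for q
    using A by (simp add: subst_mat_def)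
  have s: "subst_mat q A $$ (i, j) = subst_poly q (A $$ (i, j))" if "i < n" "j < n" for q i j
    using A that by (simp add: subst_mat_def)
  have "map_mat (\<lambda>f. poly f 0) A = 1\<^sub>m n \<longleftrightarrow>
      (\<forall>i<n. \<forall>j<n. coeff (A $$ (i, j)) 0 = (if i = j then 1 else 0))"
    by (subst mat_eq_iff[of _ n n]) (use A in \<open>auto simp: poly_0_coeff_0\<close>)
  moreover have "subst_mat var_T A * subst_mat var_T' A = subst_mat (var_T + var_T') A \<longleftrightarrow>
    (\<forall>i<n. \<forall>j<n. (\<Sum>k<n. subst_poly var_T (A $$ (i, k)) * subst_poly var_T' (A $$ (k, j)))
        = subst_poly (var_T + var_T') (A $$ (i, j)))"
    by (subst mat_eq_iff[OF mult_carrier_mat[OF c c] c])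
      (simp add: mat_mult_index[OF c c] s del: index_mult_mat)
  ultimately show ?thesis
    unfolding exponential_mat_def using A by blast
qed

text \<open>Comparing both sides of the defining identity at T^l T'^m replaces one equation over
  k[T, T'] by relations between matrices over k.\<close>

lemma exponential_mat_iff_coeff:
  assumes A: "A \<in> carrier_mat n n"
  shows "exponential_mat n A \<longleftrightarrow> coeff_mat A 0 = 1\<^sub>m n \<and>
    (\<forall>l m. coeff_mat A l * coeff_mat A m
        = of_nat ((l + m) choose l) \<cdot>\<^sub>m coeff_mat A (l + m))"
proof -
  note c = coeff_mat_carrier[OF A]
  have entry: "(\<Sum>k<n. subst_poly var_T (A $$ (i, k)) * subst_poly var_T' (A $$ (k, j)))
        = subst_poly (var_T + var_T') (A $$ (i, j)) \<longleftrightarrow>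
      (\<forall>l m. (coeff_mat A l * coeff_mat A m) $$ (i, j)
        = (of_nat ((l + m) choose l) \<cdot>\<^sub>m coeff_mat A (l + m)) $$ (i, j))"
    if "i < n" "j < n" for i j
  proof -
    have "(coeff_mat A l * coeff_mat A m) $$ (i, j)
        = coeff (coeff (\<Sum>k<n. subst_poly var_T (A $$ (i, k)) * subst_poly var_T' (A $$ (k, j))) m) l"
      for l m
      using that A by (simp add: mat_mult_index[OF c c] coeff_sum coeff_subst_poly_T_mult_T'
          del: index_mult_mat)
    moreover have "(of_nat ((l + m) choose l) \<cdot>\<^sub>m coeff_mat A (l + m)) $$ (i, j)
        = coeff (coeff (subst_poly (var_T + var_T') (A $$ (i, j))) m) l" for l m
      using that A by (simp add: coeff_subst_poly_T_plus_T')
    ultimately show ?thesis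
      by (simp only: poly_eq_iff) blast
  qed
  have zero: "coeff_mat A 0 = 1\<^sub>m n \<longleftrightarrow>
      (\<forall>i<n. \<forall>j<n. coeff (A $$ (i, j)) 0 = (if i = j then 1 else 0))"
    by (subst mat_eq_iff[of _ n n]) (use A in auto)
  have prod: "(coeff_mat A l * coeff_mat A m
        = of_nat ((l + m) choose l) \<cdot>\<^sub>m coeff_mat A (l + m)) \<longleftrightarrow>
      (\<forall>i<n. \<forall>j<n. (coeff_mat A l * coeff_mat A m) $$ (i, j)
        = (of_nat ((l + m) choose l) \<cdot>\<^sub>m coeff_mat A (l + m)) $$ (i, j))" for l m
    by (rule mat_eq_iff) (use A in auto)
  show ?thesis
    unfolding exponential_mat_iff_entries[OF A] zero prod
    by (simp only: entry cong: conj_cong imp_cong) blast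
qed

section \<open>Change of basis\<close>

lemma coeff_mat_conj:
  assumes A: "A \<in> carrier_mat n n" and Q: "Q \<in> carrier_mat n n" and P: "P \<in> carrier_mat n n"
  shows "coeff_mat (map_mat (\<lambda>c. [:c:]) Q * A * map_mat (\<lambda>c. [:c:]) P) m = Q * coeff_mat A m * P"
proof -
  let ?Q = "map_mat (\<lambda>c. [:c:]) Q" and ?P = "map_mat (\<lambda>c. [:c:]) P"
  have Q': "?Q \<in> carrier_mat n n" and P': "?P \<in> carrier_mat n n"
    using Q P by auto
  note QA = mult_carrier_mat[OF Q' A] and cA = coeff_mat_carrier[OF A]
  have "coeff ((?Q * A * ?P) $$ (i, j)) m = (Q * coeff_mat A m * P) $$ (i, j)"
    if "i < n" "j < n" for i j
    using that A Q P by (simp add: mat_mult_index[OF QA P'] mat_mult_index[OF Q' A]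
        mat_mult_index[OF mult_carrier_mat[OF Q cA] P] mat_mult_index[OF Q cA] coeff_sum
        mult.commute[of _ "[:_:]"] sum_distrib_left mult_ac
        del: index_mult_mat(1) assoc_mult_mat)
  then show ?thesis
    using A Q P by (intro eq_matI) auto
qed

lemma exponential_mat_conj:
  assumes A: "A \<in> carrier_mat n n" and Q: "Q \<in> carrier_mat n n" and P: "P \<in> carrier_mat n n"
    and QP: "Q * P = 1\<^sub>m n" and PQ: "P * Q = 1\<^sub>m n" and exp: "exponential_mat n A"
  shows "exponential_mat n (map_mat (\<lambda>c. [:c:]) Q * A * map_mat (\<lambda>c. [:c:]) P)"
proof -
  have B: "map_mat (\<lambda>c. [:c:]) Q * A * map_mat (\<lambda>c. [:c:]) P \<in> carrier_mat n n"
    using A Q P by auto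
  have c: "coeff_mat A l \<in> carrier_mat n n" for l
    using A by simp
  have e: "coeff_mat A 0 = 1\<^sub>m n" "coeff_mat A l * coeff_mat A m
        = of_nat ((l + m) choose l) \<cdot>\<^sub>m coeff_mat A (l + m)" for l m
    using exp exponential_mat_iff_coeff[OF A] by blast+
  have hom: "(Q * X * P) * (Q * Y * P) = Q * (X * Y) * P"
    if X: "X \<in> carrier_mat n n" and Y: "Y \<in> carrier_mat n n" for X Y
  proof -
    have "(Q * X * P) * (Q * Y * P) = Q * X * (P * (Q * Y * P))"
      using X Y Q P by (intro assoc_mult_mat[of _ n n _ n _ n]) auto
    also have "P * (Q * Y * P) = (P * Q) * (Y * P)"
      using X Y Q P by (simp add: assoc_mult_mat[of _ n n _ n _ n])
    also have "\<dots> = Y * P"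
      using Y P by (simp add: PQ)
    also have "Q * X * (Y * P) = Q * (X * Y) * P"
      using X Y Q P by (simp add: assoc_mult_mat[of _ n n _ n _ n])
    finally show ?thesis .
  qed
  have "(Q * coeff_mat A l * P) * (Q * coeff_mat A m * P)
      = of_nat ((l + m) choose l) \<cdot>\<^sub>m (Q * coeff_mat A (l + m) * P)" for l m
    unfolding hom[OF c c] e(2) mult_smult_distrib[OF Q c]
      mult_smult_assoc_mat[OF mult_carrier_mat[OF Q c] P] ..
  then show ?thesis
    unfolding exponential_mat_iff_coeff[OF B] coeff_mat_conj[OF A Q P]
    using Q e QP by simp
qed

text \<open>The inverses of the base changes need not be exhibited: a trivial kernel makes the
  determinant nonzero, and a left inverse of a square matrix is two-sided.\<close>

lemma inverse_mat_if_injective: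
  fixes P :: "'a::field mat"
  assumes P: "P \<in> carrier_mat n n"
    and inj: "\<And>v. v \<in> carrier_vec n \<Longrightarrow> P *\<^sub>v v = 0\<^sub>v n \<Longrightarrow> v = 0\<^sub>v n"
  obtains Q where "Q \<in> carrier_mat n n" "Q * P = 1\<^sub>m n" "P * Q = 1\<^sub>m n"
proof -
  have "det P \<noteq> 0"
    using det_0_iff_vec_prod_zero_field[OF P] inj by blast
  then obtain Q where Q: "Q \<in> carrier_mat n n" "Q * P = 1\<^sub>m n"
    using det_non_zero_imp_unit[OF P, of "()"]
    by (auto simp: Units_def ring_mat_def)
  with mat_mult_left_right_inverse[OF Q(1) P Q(2)] that show thesis
    by blast
qed

section \<open>Vanishing products\<close>

text \<open>Minimality of \<open>r\<close>: a functional vanishing on the image gives a base change that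
  makes one more row zero.\<close>

lemma common_image_normal_form:
  fixes S :: "'a::field mat set"
  assumes S: "S \<subseteq> carrier_mat n n"
  obtains r Q P where "r \<le> n" "Q \<in> carrier_mat n n" "P \<in> carrier_mat n n"
    "Q * P = 1\<^sub>m n" "P * Q = 1\<^sub>m n"
    "\<And>N i j. N \<in> S \<Longrightarrow> r \<le> i \<Longrightarrow> i < n \<Longrightarrow> j < n \<Longrightarrow> (Q * N) $$ (i, j) = 0"
    "\<And>c k. (\<And>N j. N \<in> S \<Longrightarrow> j < n \<Longrightarrow> (\<Sum>i<r. c i * (Q * N) $$ (i, j)) = 0) \<Longrightarrow> k < r \<Longrightarrow> c k = 0"
proof -
  \<comment> \<open>The least such r is the dimension of the span of all columns of all members of
    \<open>S\<close>.\<close>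
  define R where "R r \<longleftrightarrow> r \<le> n \<and> (\<exists>Q P. Q \<in> carrier_mat n n \<and> P \<in> carrier_mat n n \<and>
    Q * P = 1\<^sub>m n \<and> P * Q = 1\<^sub>m n \<and>
    (\<forall>N\<in>S. \<forall>i<n. \<forall>j<n. r \<le> i \<longrightarrow> (Q * N) $$ (i, j) = 0))" for r
  define r where "r = (LEAST r. R r)"
  have "R n"
    unfolding R_def by (auto intro!: exI[of _ "1\<^sub>m n"])
  then have "R r"
    unfolding r_def by (rule LeastI)
  then obtain Q P where r: "r \<le> n" and Q: "Q \<in> carrier_mat n n" and P: "P \<in> carrier_mat n n"
    and QP: "Q * P = 1\<^sub>m n" and PQ: "P * Q = 1\<^sub>m n"
    and zero: "\<And>N i j. N \<in> S \<Longrightarrow> r \<le> i \<Longrightarrow> i < n \<Longrightarrow> j < n \<Longrightarrow> (Q * N) $$ (i, j) = 0"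
    unfolding R_def by blast
  have "c s = 0" if c: "\<And>N j. N \<in> S \<Longrightarrow> j < n \<Longrightarrow> (\<Sum>i<r. c i * (Q * N) $$ (i, j)) = 0"
    and s: "s < r" for c s
  proof (rule ccontr)
    assume cs: "c s \<noteq> 0"
    \<comment> \<open>\<open>E\<close> puts the combination of the first r rows with coefficients
      \<open>c\<close> into row r - 1 and saves the old row r - 1 in place of row s. It is
      invertible because c s is nonzero; for s = r - 1 only the replacement takes place.\<close>
    define E where "E = mat n n (\<lambda>(i, j). if i = r - 1 then (if j < r then c j else 0)
      else if i = s then (if j = r - 1 then 1 else 0) else (if j = i then 1 else 0))"
    have E: "E \<in> carrier_mat n n"
      by (simp add: E_def)
    have row: "(E * X) $$ (i, j) = (if i = r - 1 then (\<Sum>k<r. c k * X $$ (k, j))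
        else if i = s then X $$ (r - 1, j) else X $$ (i, j))"
      if X: "X \<in> carrier_mat n m" and ij: "i < n" "j < m" for X i j m
    proof -
      have "(\<Sum>k<n. (if k < r then c k else 0) * X $$ (k, j)) = (\<Sum>k<r. c k * X $$ (k, j))"
        using r by (intro sum.mono_neutral_cong_right) auto
      moreover have "(\<Sum>k<n. (if k = i' then 1 else 0) * X $$ (k, j)) = X $$ (i', j)"
        if "i' < n" for i'
        using that by (simp add: if_distrib[of "\<lambda>x. x * _"] sum.delta cong: if_cong)
      ultimately show ?thesis
        unfolding mat_mult_index[OF E X ij] using ij r s by (auto simp: E_def)
    qed
    obtain F where F: "F \<in> carrier_mat n n" "F * E = 1\<^sub>m n" "E * F = 1\<^sub>m n"
    proof (rule inverse_mat_if_injective[OF E])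
      fix v :: "'a vec"
      assume v: "v \<in> carrier_vec n" and Ev: "E *\<^sub>v v = 0\<^sub>v n"
      \<comment> \<open>The vector is turned into a one-column matrix so that \<open>row\<close>
        applies to it.\<close>
      define X where "X = mat n 1 (\<lambda>(i, j). v $ i)"
      have X: "X \<in> carrier_mat n 1"
        by (simp add: X_def)
      have "(E * X) $$ (i, 0) = 0" if "i < n" for i
      proof -
        have "(E * X) $$ (i, 0) = (E *\<^sub>v v) $ i"
          using that v E by (simp add: X_def scalar_prod_def)
        then show ?thesis
          using Ev that by simp
      qed
      then have eq: "(if i = r - 1 then (\<Sum>k<r. c k * v $ k)
        else if i = s then v $ (r - 1) else v $ i) = 0" if "i < n" for i
        using row[OF X that] that r s by (auto simp: X_def split: if_splits)
      \<comment> \<open>Row s of \<open>E\<close> returns the entry r - 1, and every row other than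
        r - 1 and s returns its own entry. Then only c s * v s is left in row r - 1.\<close>
      have "v $ i = 0" if "i < n" "i \<noteq> s" for i
        using eq[of i] eq[of s] that s r by (auto split: if_splits)
      moreover from this have "(\<Sum>k<r. c k * v $ k) = c s * v $ s"
        using s r by (subst sum.remove[of _ s]) (auto intro!: sum.neutral)
      then have "v $ s = 0"
        using eq[of "r - 1"] cs s r by auto
      ultimately show "v = 0\<^sub>v n"
        using v by (intro eq_vecI) auto
    qed
    have "R (r - 1)"
      unfolding R_def
    proof (intro conjI exI ballI allI impI)
      show "E * Q \<in> carrier_mat n n" "P * F \<in> carrier_mat n n"
        using E Q P F by auto
      have "E * Q * (P * F) = E * (Q * P) * F"
        using E Q P F(1) by (simp add: assoc_mult_mat[of _ n n _ n _ n])
      then show "E * Q * (P * F) = 1\<^sub>m n"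
        using E F by (simp add: QP)
      have "P * F * (E * Q) = P * (F * E) * Q"
        using E Q P F(1) by (simp add: assoc_mult_mat[of _ n n _ n _ n])
      then show "P * F * (E * Q) = 1\<^sub>m n"
        using P F PQ by simp
      show "r - 1 \<le> n"
        using r by simp
      fix N i j
      assume N: "N \<in> S" and ij: "i < n" "j < n" "r - 1 \<le> i"
      have "E * Q * N = E * (Q * N)"
        using E Q N S by (intro assoc_mult_mat) auto
      moreover have "Q * N \<in> carrier_mat n n"
        using Q N S by auto
      ultimately show "(E * Q * N) $$ (i, j) = 0"
        using row[of "Q * N" n i j] ij c[OF N] zero[OF N, of i j] s by (auto simp del: index_mult_mat(1))
    qed
    \<comment> \<open>Since s < r, r is positive and r - 1 is a genuine decrease.\<close>
    then have "r \<le> r - 1"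
      unfolding r_def by (rule Least_le)
    then show False
      using s by simp
  qed
  with that r Q P QP PQ zero show thesis
    by blast
qed

section \<open>Exponentiality of the four forms\<close>

lemma lessThan_4: "{..<4} = {0, 1, 2, 3 :: nat}"
  by auto

lemma all_less_4: "(\<forall>i<4. R i) \<longleftrightarrow> R 0 \<and> R 1 \<and> R 2 \<and> R (3 :: nat)"
  using lessThan_4 by (metis insert_iff lessThan_iff singletonD)

lemma mat_of_rows_list_index:
  "i < length rs \<Longrightarrow> j < n \<Longrightarrow> mat_of_rows_list n rs $$ (i, j) = rs ! i ! j"
  by (simp add: mat_of_rows_list_def)

lemma mat_of_rows_list_carrier:
  "length rs = r \<Longrightarrow> mat_of_rows_list n rs \<in> carrier_mat r n"
  by (simp add: mat_of_rows_list_def)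

lemma mat_eq_rows_4:
  assumes "B \<in> carrier_mat 4 4"
    and "B $$ (0, 0) = a00" "B $$ (0, 1) = a01" "B $$ (0, 2) = a02" "B $$ (0, 3) = a03"
    and "B $$ (1, 0) = a10" "B $$ (1, 1) = a11" "B $$ (1, 2) = a12" "B $$ (1, 3) = a13"
    and "B $$ (2, 0) = a20" "B $$ (2, 1) = a21" "B $$ (2, 2) = a22" "B $$ (2, 3) = a23"
    and "B $$ (3, 0) = a30" "B $$ (3, 1) = a31" "B $$ (3, 2) = a32" "B $$ (3, 3) = a33"
  shows "B = mat_of_rows_list 4
    [[a00, a01, a02, a03], [a10, a11, a12, a13], [a20, a21, a22, a23], [a30, a31, a32, a33]]"
    (is "B = mat_of_rows_list 4 ?rows")
proof -
  have rows: "mat_of_rows_list 4 ?rows \<in> carrier_mat 4 4"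
    by (rule mat_of_rows_list_carrier) simp
  show ?thesis
    unfolding mat_eq_iff[OF assms(1) rows] all_less_4 using assms(2-)
    by (simp add: mat_of_rows_list_index)
qed

text \<open>With list indexing, explicit rows reduce exponentiality to sixteen scalar conditions
  that can be evaluated.\<close>

lemma exponential_rows_4:
  assumes "rs = [[a00, a01, a02, a03], [a10, a11, a12, a13], [a20, a21, a22, a23], [a30, a31, a32, a33]]"
  shows "exponential_mat 4 (mat_of_rows_list 4 rs) \<longleftrightarrow>
    (\<forall>i<4. \<forall>j<4. coeff (rs ! i ! j) 0 = (if i = j then 1 else 0) \<and>
      (\<Sum>k<4. subst_poly var_T (rs ! i ! k) * subst_poly var_T' (rs ! k ! j))
        = subst_poly (var_T + var_T') (rs ! i ! j))"
proof -
  have "mat_of_rows_list 4 rs \<in> carrier_mat 4 4"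
    by (rule mat_of_rows_list_carrier) (simp add: assms)
  moreover have "length rs = 4"
    using assms by simp
  ultimately show ?thesis
    by (simp add: exponential_mat_iff_entries mat_of_rows_list_index)
qed

lemmas exponential_rows_4_simps =
  exponential_rows_4[OF refl] all_less_4 lessThan_4 additive_poly_def add.commute

text \<open>Here, and in the next two forms, A = 1 + N with N(T) N(T') = 0, so the exponential law
  is additivity of each entry. One direction shows that the forms are exponential, the other
  recovers p-polynomials from a matrix already in shape.\<close>

lemma exponential_form1_iff:
  "exponential_mat 4 (mat_of_rows_list 4
    [[1, a, b, c], [0, 1, 0, 0], [0, 0, 1, 0], [0, 0, 0, 1]]) \<longleftrightarrow>
   additive_poly a \<and> additive_poly b \<and> additive_poly c"
  using additive_poly_coeff(1)[of a] additive_poly_coeff(1)[of b] additive_poly_coeff(1)[of c]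
  by (auto simp: exponential_rows_4_simps)

lemma exponential_form2_iff:
  "exponential_mat 4 (mat_of_rows_list 4
    [[1, 0, a, b], [0, 1, c, d], [0, 0, 1, 0], [0, 0, 0, 1]]) \<longleftrightarrow>
   additive_poly a \<and> additive_poly b \<and> additive_poly c \<and> additive_poly d"
  using additive_poly_coeff(1)[of a] additive_poly_coeff(1)[of b] additive_poly_coeff(1)[of c]
    additive_poly_coeff(1)[of d]
  by (auto simp: exponential_rows_4_simps)

lemma exponential_form3_iff:
  "exponential_mat 4 (mat_of_rows_list 4
    [[1, 0, 0, a], [0, 1, 0, b], [0, 0, 1, c], [0, 0, 0, 1]]) \<longleftrightarrow>
   additive_poly a \<and> additive_poly b \<and> additive_poly c"
  using additive_poly_coeff(1)[of a] additive_poly_coeff(1)[of b] additive_poly_coeff(1)[of c]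
  by (auto simp: exponential_rows_4_simps)

lemma additive_poly_smult: "additive_poly f \<Longrightarrow> additive_poly (smult c f)"
  by (simp add: additive_poly_def subst_poly_smult algebra_simps)

text \<open>The product ab fails to be additive exactly by a(T) b(T') + b(T) a(T'). Scaled by
  \<open>\<mu>\<close>, this is what the two middle terms of the corner contribute, so the condition
  left there is additivity of c.\<close>

lemma exponential_form4_iff:
  "exponential_mat 4 (mat_of_rows_list 4
    [[1, a, b, smult \<mu> (a * b) + c], [0, 1, 0, smult \<mu> b], [0, 0, 1, smult \<mu> a], [0, 0, 0, 1]]) \<longleftrightarrow>
   additive_poly a \<and> additive_poly b \<and> additive_poly c" (is "?E \<longleftrightarrow> _")
proof -
  let ?s = "subst_poly (var_T + var_T') :: 'a poly \<Rightarrow> _"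
  let ?t = "subst_poly var_T :: 'a poly \<Rightarrow> _" and ?t' = "subst_poly var_T' :: 'a poly \<Rightarrow> _"
  \<comment> \<open>The left side is the sum over k = 0, 1, 2, 3 for the entry (0, 3).\<close>
  have corner: "?t' (smult \<mu> (a * b) + c) + (?t a * ?t' (smult \<mu> b) + (?t b * ?t' (smult \<mu> a)
      + ?t (smult \<mu> (a * b) + c))) = ?s (smult \<mu> (a * b) + c) \<longleftrightarrow> additive_poly c"
    if "?s a = ?t a + ?t' a" "?s b = ?t b + ?t' b"
  proof -
    have "?s (smult \<mu> (a * b) + c) - (?t' (smult \<mu> (a * b) + c) + (?t a * ?t' (smult \<mu> b)
        + (?t b * ?t' (smult \<mu> a) + ?t (smult \<mu> (a * b) + c)))) = ?s c - (?t c + ?t' c)"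
      by (simp add: subst_poly_add subst_poly_mult subst_poly_smult that algebra_simps)
    then show ?thesis
      unfolding additive_poly_def by (metis eq_iff_diff_eq_0)
  qed
  have "?E \<longleftrightarrow> (additive_poly a \<and> additive_poly b) \<and> 
    (coeff a 0 = 0 \<and> coeff b 0 = 0 \<and> coeff c 0 = 0) \<and>
    ?t' (smult \<mu> (a * b) + c) + (?t a * ?t' (smult \<mu> b) + (?t b * ?t' (smult \<mu> a)
      + ?t (smult \<mu> (a * b) + c))) = ?s (smult \<mu> (a * b) + c)"
    using additive_poly_smult[of a \<mu>] additive_poly_smult[of b \<mu>]
    by (auto simp: exponential_rows_4[OF refl] all_less_4 lessThan_4 additive_poly_def coeff_mult
        add.commute[of "?t' a"] add.commute[of "?t' b"] add.commute[of "?t' (smult _ _)" "?t (smult _ _)"])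
  then show ?thesis
    using corner additive_poly_coeff(1)[of a] additive_poly_coeff(1)[of b]
      additive_poly_coeff(1)[of c] additive_poly_def by blast
qed

lemma exponential_mat_coeff:
  assumes A: "exponential_mat n A"
  shows "A \<in> carrier_mat n n"
    and "coeff_mat A 0 = 1\<^sub>m n"
    and "coeff_mat A l * coeff_mat A m = of_nat ((l + m) choose l) \<cdot>\<^sub>m coeff_mat A (l + m)"
    and "coeff_mat A l * coeff_mat A m = coeff_mat A m * coeff_mat A l"
proof -
  show c: "A \<in> carrier_mat n n"
    using A by (simp add: exponential_mat_def)
  show "coeff_mat A 0 = 1\<^sub>m n"
    and e: "coeff_mat A l * coeff_mat A m = of_nat ((l + m) choose l) \<cdot>\<^sub>m coeff_mat A (l + m)" for l m
    using A exponential_mat_iff_coeff[OF c] by blast+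
  \<comment> \<open>By symmetry both products are the same multiple of the same coefficient
    matrix.\<close>
  have "(l + m) choose l = (m + l) choose m"
    using binomial_symmetric[of l "l + m"] by (simp add: add.commute)
  then show "coeff_mat A l * coeff_mat A m = coeff_mat A m * coeff_mat A l"
    by (simp add: e add.commute)
qed

text \<open>After the base change, rows from r on vanish in all positive coefficients because they
  are outside the image, and columns before r vanish because the image lies in the kernel. Only the
  upper right r by 4 - r block survives, and its size decides the form.\<close>

lemma products_zero_imp_form:
  fixes A :: "'a::field poly mat"
  assumes p: "prime p" "CHAR('a) = p" and exp: "exponential_mat 4 A"
    and zero: "\<And>l m. l > 0 \<Longrightarrow> m > 0 \<Longrightarrow> coeff_mat A l * coeff_mat A m = 0\<^sub>m 4 4"
  shows "\<exists>B \<in> form1 p \<union> form2 p \<union> form3 p. equivalent_mat 4 A B"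
proof -
  note A = exponential_mat_coeff(1)[OF exp]
  have cA: "coeff_mat A l \<in> carrier_mat 4 4" for l
    using A by simp
  obtain r Q P where r: "r \<le> 4" and Q: "Q \<in> carrier_mat 4 4" and P: "P \<in> carrier_mat 4 4"
    and QP: "Q * P = 1\<^sub>m 4" and PQ: "P * Q = 1\<^sub>m 4"
    and rows: "\<And>N i j. N \<in> coeff_mat A ` {0<..} \<Longrightarrow> r \<le> i \<Longrightarrow> i < 4 \<Longrightarrow> j < 4
      \<Longrightarrow> (Q * N) $$ (i, j) = 0"
    and indep: "\<And>c k. (\<And>N j. N \<in> coeff_mat A ` {0<..} \<Longrightarrow> j < 4
      \<Longrightarrow> (\<Sum>i<r. c i * (Q * N) $$ (i, j)) = 0) \<Longrightarrow> k < r \<Longrightarrow> c k = 0"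
    by (rule common_image_normal_form[of "coeff_mat A ` {0<..}" 4]) (use cA in blast)+
  define B where "B = map_mat (\<lambda>c. [:c:]) Q * A * map_mat (\<lambda>c. [:c:]) P"
  have exp_B: "exponential_mat 4 B"
    unfolding B_def by (rule exponential_mat_conj[OF A Q P QP PQ exp])
  note B = exponential_mat_coeff(1)[OF exp_B]
  have coeff_B: "coeff (B $$ (i, j)) l = (Q * coeff_mat A l * P) $$ (i, j)" if "i < 4" "j < 4" for i j l
    using that B coeff_mat_conj[OF A Q P, folded B_def] by (metis carrier_matD coeff_mat_index)
  have entry: "B $$ (i, j) = (if i = j then 1 else 0)" if ij: "i < 4" "j < 4" "r \<le> i \<or> j < r" for i j
  proof (rule poly_eqI)
    fix l
    show "coeff (B $$ (i, j)) l = coeff (if i = j then 1 else 0) l"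
    proof (cases "l = 0")
      case True
      then show ?thesis
        using ij by (simp add: coeff_B exponential_mat_coeff(2)[OF exp] right_mult_one_mat[OF Q] QP)
    next
      case False
      have "(Q * coeff_mat A l * P) $$ (i, j) = 0"
      proof (cases "r \<le> i")
        case True
        then show ?thesis
          using rows[of "coeff_mat A l" i] False ij
          by (simp add: mat_mult_index[OF mult_carrier_mat[OF Q cA] P] del: index_mult_mat(1) assoc_mult_mat)
      next
        \<comment> \<open>Row i of \<open>?M\<close> is a linear relation among the first r rows of
          all the \<open>Q * N\<close>: the product with \<open>Q * N\<close> is Q A_l A_m = 0, and
          the rows of \<open>Q * N\<close> from r on are zero. Independence of the first r rows
          makes its entries before r vanish.\<close>
        case i: False
        let ?M = "Q * coeff_mat A l * P"
        have M: "?M \<in> carrier_mat 4 4"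
          using Q P cA[of l] by (intro mult_carrier_mat[where n = 4])
        have "(\<Sum>k<r. ?M $$ (i, k) * (Q * N) $$ (k, j')) = 0"
          if N: "N \<in> coeff_mat A ` {0<..}" and j': "j' < 4" for N j'
        proof -
          obtain m where m: "m > 0" "N = coeff_mat A m"
            using N by auto
          have QN: "Q * N \<in> carrier_mat 4 4"
            using Q cA m by auto
          have "?M * (Q * N) = Q * (coeff_mat A l * ((P * Q) * N))"
            using Q P cA[of l] cA[of m] unfolding m(2) by (simp add: assoc_mult_mat[of _ 4 4 _ 4 _ 4])
          also have "\<dots> = 0\<^sub>m 4 4"
            using zero[of l m] False m Q by (simp add: PQ left_mult_one_mat[OF cA])
          finally have "0 = (?M * (Q * N)) $$ (i, j')"
            using ij j' by simp
          also have "\<dots> = (\<Sum>k<4. ?M $$ (i, k) * (Q * N) $$ (k, j'))"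
            by (rule mat_mult_index[OF M QN ij(1) j'])
          also have "\<dots> = (\<Sum>k<r. ?M $$ (i, k) * (Q * N) $$ (k, j'))"
            using r rows[OF N _ _ j'] by (intro sum.mono_neutral_right) auto
          finally show ?thesis ..
        qed
        then show ?thesis
          using indep[of "\<lambda>k. ?M $$ (i, k)" j] i ij by auto
      qed
      then show ?thesis
        using False ij by (auto simp: coeff_B coeff_eq_0)
    qed
  qed
  note p_poly = additive_poly_iff_p_polynomial[OF p]
  have "B \<in> form1 p \<union> form2 p \<union> form3 p"
  proof -
    consider "r = 0" | "r = 1" | "r = 2" | "r = 3" | "r = 4"
      using r by linarith
    then show ?thesis
    proof cases
      case 1
      have "B = mat_of_rows_list 4 [[1, 0, 0, 0], [0, 1, 0, 0], [0, 0, 1, 0], [0, 0, 0, 1]]"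
        by (rule mat_eq_rows_4[OF B]) (simp_all add: entry 1)
      with exp_B show ?thesis
        by (auto simp: exponential_form1_iff p_poly form1_def)
    next
      case 2
      have "B = mat_of_rows_list 4
          [[1, B $$ (0, 1), B $$ (0, 2), B $$ (0, 3)], [0, 1, 0, 0], [0, 0, 1, 0], [0, 0, 0, 1]]"
        by (rule mat_eq_rows_4[OF B]) (simp_all add: entry 2)
      \<comment> \<open>Naming the entries removes \<open>B\<close> from the right-hand side, so
        that the equation can rewrite \<open>B\<close>.\<close>
      then obtain a b c where eq: "B = mat_of_rows_list 4
          [[1, a, b, c], [0, 1, 0, 0], [0, 0, 1, 0], [0, 0, 0, 1]]"
        by blast
      from exp_B show ?thesis
        unfolding eq exponential_form1_iff p_poly form1_def by blast
    next
      case 3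
      have "B = mat_of_rows_list 4
          [[1, 0, B $$ (0, 2), B $$ (0, 3)], [0, 1, B $$ (1, 2), B $$ (1, 3)], [0, 0, 1, 0], [0, 0, 0, 1]]"
        by (rule mat_eq_rows_4[OF B]) (simp_all add: entry 3)
      then obtain a b c d where eq: "B = mat_of_rows_list 4
          [[1, 0, a, b], [0, 1, c, d], [0, 0, 1, 0], [0, 0, 0, 1]]"
        by blast
      from exp_B show ?thesis
        unfolding eq exponential_form2_iff p_poly form2_def by blast
    next
      case 4
      have "B = mat_of_rows_list 4
          [[1, 0, 0, B $$ (0, 3)], [0, 1, 0, B $$ (1, 3)], [0, 0, 1, B $$ (2, 3)], [0, 0, 0, 1]]"
        by (rule mat_eq_rows_4[OF B]) (simp_all add: entry 4)
      then obtain a b c where eq: "B = mat_of_rows_list 4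
          [[1, 0, 0, a], [0, 1, 0, b], [0, 0, 1, c], [0, 0, 0, 1]]"
        by blast
      from exp_B show ?thesis
        unfolding eq exponential_form3_iff p_poly form3_def by blast
    next
      \<comment> \<open>Every column now lies before r, so \<open>B\<close> is again the
        identity.\<close>
      case 5
      have "B = mat_of_rows_list 4 [[1, 0, 0, 0], [0, 1, 0, 0], [0, 0, 1, 0], [0, 0, 0, 1]]"
        by (rule mat_eq_rows_4[OF B]) (simp_all add: entry 5)
      with exp_B show ?thesis
        by (auto simp: exponential_form1_iff p_poly form1_def)
    qed
  qed
  moreover have "equivalent_mat 4 A B"
    unfolding equivalent_mat_def B_def inverts_mat_def using P Q PQ QP by auto
  ultimately show ?thesis
    by blast
qed

section \<open>A nonzero product\<close>

text \<open>Multiplication by \<open>X\<close> and by \<open>Y\<close> on \<open>k[X, Y]/(X\<^sup>2, Y\<^sup>2)\<close> in the basis \<open>X Y, Y, X, 1\<close>.\<close>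

definition nil_X :: "'a::zero_neq_one mat" where
  "nil_X = mat 4 4 (\<lambda>ij. if ij \<in> {(0, 1), (2, 3)} then 1 else 0)"

definition nil_Y :: "'a::zero_neq_one mat" where
  "nil_Y = mat 4 4 (\<lambda>ij. if ij \<in> {(0, 2), (1, 3)} then 1 else 0)"

lemma nil_carrier: "nil_X \<in> carrier_mat 4 4" "nil_Y \<in> carrier_mat 4 4"
  by (simp_all add: nil_X_def nil_Y_def)

lemma nil_X_index: "i < 4 \<Longrightarrow> j < 4 \<Longrightarrow>
    nil_X $$ (i, j) = (if (i, j) \<in> {(0, 1), (2, 3)} then 1 else 0)"
  by (simp add: nil_X_def)

lemma nil_Y_index: "i < 4 \<Longrightarrow> j < 4 \<Longrightarrow>
    nil_Y $$ (i, j) = (if (i, j) \<in> {(0, 2), (1, 3)} then 1 else 0)"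
  by (simp add: nil_Y_def)

text \<open>An endomorphism of a cyclic module over a commutative ring is multiplication by a ring
  element. The relations say that \<open>M\<close> is a combination of 1, X, Y, X Y with
  coefficients \<open>M $$ (0, 0)\<close>, \<open>M $$ (0, 1)\<close>, \<open>M $$ (0, 2)\<close>,
  \<open>M $$ (0, 3)\<close>.\<close>

lemma commute_nil_X_nil_Y:
  fixes M :: "'a::field mat"
  assumes M: "M \<in> carrier_mat 4 4" and "M * nil_X = nil_X * M" and "M * nil_Y = nil_Y * M"
  shows "M $$ (1, 0) = 0" "M $$ (2, 0) = 0" "M $$ (3, 0) = 0" "M $$ (2, 1) = 0"
    "M $$ (3, 1) = 0" "M $$ (1, 2) = 0" "M $$ (3, 2) = 0"
    "M $$ (1, 1) = M $$ (0, 0)" "M $$ (2, 2) = M $$ (0, 0)" "M $$ (3, 3) = M $$ (0, 0)"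
    "M $$ (2, 3) = M $$ (0, 1)" "M $$ (1, 3) = M $$ (0, 2)"
proof -
  have "(\<Sum>k<4. M $$ (i, k) * N $$ (k, j)) = (\<Sum>k<4. N $$ (i, k) * M $$ (k, j))"
    if "N \<in> carrier_mat 4 4" "M * N = N * M" "i < 4" "j < 4" for N i j
    using that(2) mat_mult_index[OF M that(1,3,4)] mat_mult_index[OF that(1) M that(3,4)] by simp
  from this[OF nil_carrier(1) assms(2)] this[OF nil_carrier(2) assms(3)]
  have x: "\<forall>i<4. \<forall>j<4. (\<Sum>k<4. M $$ (i, k) * nil_X $$ (k, j)) = (\<Sum>k<4. nil_X $$ (i, k) * M $$ (k, j))"
    and y: "\<forall>i<4. \<forall>j<4. (\<Sum>k<4. M $$ (i, k) * nil_Y $$ (k, j)) = (\<Sum>k<4. nil_Y $$ (i, k) * M $$ (k, j))"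
    by blast+
  show "M $$ (1, 0) = 0" "M $$ (2, 0) = 0" "M $$ (3, 0) = 0" "M $$ (2, 1) = 0"
    "M $$ (3, 1) = 0" "M $$ (1, 2) = 0" "M $$ (3, 2) = 0"
    "M $$ (1, 1) = M $$ (0, 0)" "M $$ (2, 2) = M $$ (0, 0)" "M $$ (3, 3) = M $$ (0, 0)"
    "M $$ (2, 3) = M $$ (0, 1)" "M $$ (1, 3) = M $$ (0, 2)"
    using x y unfolding all_less_4 lessThan_4
    by (simp_all add: nil_X_index nil_Y_index del: One_nat_def)
qed

section \<open>A basis from a nonzero product\<close>

lemma mult_mat_vec_index:
  "A \<in> carrier_mat r n \<Longrightarrow> v \<in> carrier_vec n \<Longrightarrow> i < r \<Longrightarrow>
    (A *\<^sub>v v) $ i = (\<Sum>k<n. A $$ (i, k) * v $ k)"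
  by (auto simp: scalar_prod_def atLeast0LessThan intro!: sum.cong)

lemma mult_mat_vec_nonzero:
  fixes A :: "'a::field mat"
  assumes A: "A \<in> carrier_mat n n" and "A \<noteq> 0\<^sub>m n n"
  obtains v where "v \<in> carrier_vec n" "A *\<^sub>v v \<noteq> 0\<^sub>v n"
proof -
  obtain i j where ij: "i < n" "j < n" "A $$ (i, j) \<noteq> 0"
    using assms mat_eq_iff[OF A zero_carrier_mat] by auto
  have "(A *\<^sub>v unit_vec n j) $ i = (\<Sum>k<n. if k = j then A $$ (i, j) else 0)"
    unfolding mult_mat_vec_index[OF A unit_vec_carrier ij(1)]
    using ij by (intro sum.cong) auto
  then have "A *\<^sub>v unit_vec n j \<noteq> 0\<^sub>v n"
    using ij by auto
  then show thesis
    using that unit_vec_carrier by blast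
qed

text \<open>The vectors \<open>X Y v\<close>, \<open>Y v\<close>, \<open>X v\<close>, \<open>v\<close> form a basis as soon as \<open>X Y v \<noteq> 0\<close>, because
  applying \<open>X Y\<close>, \<open>X\<close> and \<open>Y\<close> to a linear relation isolates its coefficients.\<close>

lemma commuting_square_zero_basis:
  fixes X Y :: "'a::field mat"
  assumes X: "X \<in> carrier_mat 4 4" and Y: "Y \<in> carrier_mat 4 4"
    and XX: "X * X = 0\<^sub>m 4 4" and YY: "Y * Y = 0\<^sub>m 4 4" and comm: "X * Y = Y * X"
    and XY: "X * Y \<noteq> 0\<^sub>m 4 4"
  obtains P Q where "P \<in> carrier_mat 4 4" "Q \<in> carrier_mat 4 4" "Q * P = 1\<^sub>m 4" "P * Q = 1\<^sub>m 4"
    "Q * X * P = nil_X" "Q * Y * P = nil_Y"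
proof -
  obtain v where v: "v \<in> carrier_vec 4" and nz: "(X * Y) *\<^sub>v v \<noteq> 0\<^sub>v 4"
    using mult_mat_vec_nonzero[OF mult_carrier_mat[OF X Y] XY] by blast
  define u where "u = X *\<^sub>v (Y *\<^sub>v v)"
  have u: "u \<in> carrier_vec 4" "u \<noteq> 0\<^sub>v 4"
    using nz X Y v by (auto simp: u_def assoc_mult_mat_vec[of _ 4 4 _ 4])
  \<comment> \<open>With either factor in front, \<open>u\<close> is killed by both \<open>X\<close>
    and \<open>Y\<close>.\<close>
  have u': "u = Y *\<^sub>v (X *\<^sub>v v)"
    unfolding u_def using X Y v comm by (metis assoc_mult_mat_vec)
  have Xw: "X *\<^sub>v (X *\<^sub>v w) = 0\<^sub>v 4" and Yw: "Y *\<^sub>v (Y *\<^sub>v w) = 0\<^sub>v 4" if "w \<in> carrier_vec 4" for w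
    using X Y that by (auto simp: assoc_mult_mat_vec[of _ 4 4 _ 4, symmetric] XX YY intro!: eq_vecI)
  define P where "P = mat 4 4 (\<lambda>(i, j). ([u, Y *\<^sub>v v, X *\<^sub>v v, v] ! j) $ i)"
  have P: "P \<in> carrier_mat 4 4"
    by (simp add: P_def)
  have col: "col P 0 = u" "col P 1 = Y *\<^sub>v v" "col P 2 = X *\<^sub>v v" "col P 3 = v"
    using X Y v u by (auto simp: P_def intro!: eq_vecI)
  have idx: "(Z * P) $$ (i, j) = (Z *\<^sub>v col P j) $ i" if "Z \<in> carrier_mat 4 4" "i < 4" "j < 4" for Z i j
    using that P by simp
  have entries: "P $$ (i, 0) = u $ i" "P $$ (i, 1) = (Y *\<^sub>v v) $ i"
    "P $$ (i, 2) = (X *\<^sub>v v) $ i" "P $$ (i, 3) = v $ i" if "i < 4" for i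
    using that by (simp_all add: P_def)
  have "\<forall>j<4. (X * P) $$ (i, j) = (P * nil_X) $$ (i, j)" if i: "i < 4" for i
  proof -
    have cols: "X *\<^sub>v col P 0 = 0\<^sub>v 4" "X *\<^sub>v col P 1 = u" "X *\<^sub>v col P 2 = 0\<^sub>v 4" "X *\<^sub>v col P 3 = X *\<^sub>v v"
      by (simp_all add: col[unfolded One_nat_def] Xw v u_def mult_mat_vec_carrier[OF Y])
    show ?thesis
      unfolding all_less_4 using i
      by (simp add: idx[OF X] cols mat_mult_index[OF P nil_carrier(1)] lessThan_4 nil_X_index entries
          del: index_mult_mat(1) index_mult_mat_vec One_nat_def)
  qed
  then have XP: "X * P = P * nil_X"
    using mat_eq_iff[OF mult_carrier_mat[OF X P] mult_carrier_mat[OF P nil_carrier(1)]] by blast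
  have "\<forall>j<4. (Y * P) $$ (i, j) = (P * nil_Y) $$ (i, j)" if i: "i < 4" for i
  proof -
    have cols: "Y *\<^sub>v col P 0 = 0\<^sub>v 4" "Y *\<^sub>v col P 1 = 0\<^sub>v 4" "Y *\<^sub>v col P 2 = u" "Y *\<^sub>v col P 3 = Y *\<^sub>v v"
      by (simp_all add: col[unfolded One_nat_def] Yw v u' mult_mat_vec_carrier[OF X])
    show ?thesis
      unfolding all_less_4 using i
      by (simp add: idx[OF Y] cols mat_mult_index[OF P nil_carrier(2)] lessThan_4 nil_Y_index entries
          del: index_mult_mat(1) index_mult_mat_vec One_nat_def)
  qed
  then have YP: "Y * P = P * nil_Y"
    using mat_eq_iff[OF mult_carrier_mat[OF Y P] mult_carrier_mat[OF P nil_carrier(2)]] by blast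
  obtain Q where Q: "Q \<in> carrier_mat 4 4" "Q * P = 1\<^sub>m 4" "P * Q = 1\<^sub>m 4"
  proof (rule inverse_mat_if_injective[OF P])
    fix c :: "'a vec"
    assume c: "c \<in> carrier_vec 4" and Pc: "P *\<^sub>v c = 0\<^sub>v 4"
    \<comment> \<open>Because P * nil_X = X * P, the kernel of \<open>P\<close> is stable under
      \<open>nil_X\<close>: this is how X is applied to a linear relation.\<close>
    have X_step: "nil_X *\<^sub>v w \<in> carrier_vec 4 \<and> P *\<^sub>v (nil_X *\<^sub>v w) = 0\<^sub>v 4 \<and>
        (nil_X *\<^sub>v w) $ 0 = w $ 1 \<and> (nil_X *\<^sub>v w) $ 1 = 0 \<and> (nil_X *\<^sub>v w) $ 2 = w $ 3 \<and> (nil_X *\<^sub>v w) $ 3 = 0"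
      if w: "w \<in> carrier_vec 4" "P *\<^sub>v w = 0\<^sub>v 4" for w
    proof (intro conjI)
      have "P *\<^sub>v (nil_X *\<^sub>v w) = X *\<^sub>v (P *\<^sub>v w)"
        using assoc_mult_mat_vec[OF P nil_carrier(1) w(1)] assoc_mult_mat_vec[OF X P w(1)] XP by simp
      then show "P *\<^sub>v (nil_X *\<^sub>v w) = 0\<^sub>v 4"
        using w X by (auto intro!: eq_vecI)
    qed (use mult_mat_vec_carrier[OF nil_carrier(1) w(1)] in \<open>simp_all add: mult_mat_vec_index[OF nil_carrier(1) w(1)]
      lessThan_4 nil_X_index del: index_mult_mat_vec\<close>)
    have Y_step: "nil_Y *\<^sub>v w \<in> carrier_vec 4 \<and> P *\<^sub>v (nil_Y *\<^sub>v w) = 0\<^sub>v 4 \<and>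
        (nil_Y *\<^sub>v w) $ 0 = w $ 2 \<and> (nil_Y *\<^sub>v w) $ 1 = w $ 3 \<and> (nil_Y *\<^sub>v w) $ 2 = 0 \<and> (nil_Y *\<^sub>v w) $ 3 = 0"
      if w: "w \<in> carrier_vec 4" "P *\<^sub>v w = 0\<^sub>v 4" for w
    proof (intro conjI)
      have "P *\<^sub>v (nil_Y *\<^sub>v w) = Y *\<^sub>v (P *\<^sub>v w)"
        using assoc_mult_mat_vec[OF P nil_carrier(2) w(1)] assoc_mult_mat_vec[OF Y P w(1)] YP by simp
      then show "P *\<^sub>v (nil_Y *\<^sub>v w) = 0\<^sub>v 4"
        using w Y by (auto intro!: eq_vecI)
    qed (use mult_mat_vec_carrier[OF nil_carrier(2) w(1)] in \<open>simp_all add: mult_mat_vec_index[OF nil_carrier(2) w(1)]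
      lessThan_4 nil_Y_index del: index_mult_mat_vec\<close>)
    have first: "w $ 0 = 0" if w: "w \<in> carrier_vec 4" "P *\<^sub>v w = 0\<^sub>v 4"
      and "w $ 1 = 0" "w $ 2 = 0" "w $ 3 = 0" for w :: "'a vec"
    proof -
      obtain i where i: "i < 4" "u $ i \<noteq> 0"
        using u eq_vecI[of u "0\<^sub>v 4"] by auto
      have "(P *\<^sub>v w) $ i = u $ i * w $ 0"
        using that(3-) i by (simp add: mult_mat_vec_index[OF P w(1)] lessThan_4 entries
            del: index_mult_mat_vec One_nat_def)
      then show ?thesis
        using i w by simp
    qed
    note cx = X_step[OF c Pc] and cy = Y_step[OF c Pc]
    \<comment> \<open>X Y moves entry 3 to position 0 and clears the others; once entry 3 is zero, X
      does the same with entry 1 and Y with entry 2.\<close>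
    have "c $ 3 = 0"
      using X_step[of "nil_Y *\<^sub>v c"] first[of "nil_X *\<^sub>v (nil_Y *\<^sub>v c)"] cy by simp
    moreover have "c $ 1 = 0"
      using first[of "nil_X *\<^sub>v c"] cx calculation by simp
    moreover have "c $ 2 = 0"
      using first[of "nil_Y *\<^sub>v c"] cy calculation by simp
    moreover have "c $ 0 = 0"
      using first[OF c Pc] calculation by simp
    ultimately have "\<forall>i<4. c $ i = 0"
      by (simp add: all_less_4)
    then show "c = 0\<^sub>v 4"
      using c by (intro eq_vecI) auto
  qed
  have "Q * Z * P = N" if Z: "Z \<in> carrier_mat 4 4" and N: "N \<in> carrier_mat 4 4"
    and ZP: "Z * P = P * N" for Z N
  proof -
    have "Q * Z * P = Q * (P * N)"
      unfolding ZP[symmetric] by (rule assoc_mult_mat[OF Q(1) Z P])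
    also have "\<dots> = Q * P * N"
      by (rule assoc_mult_mat[OF Q(1) P N, symmetric])
    finally show ?thesis
      by (simp add: Q(2) left_mult_one_mat[OF N])
  qed
  then show thesis
    using that[OF P Q] X Y XP YP nil_carrier by blast
qed

text \<open>Pascal's rule gives a sum of two binomials that are equal by symmetry.\<close>

lemma even_central_binomial: "l > 0 \<Longrightarrow> even ((l + l) choose l)"
proof (cases l)
  case (Suc k)
  have "Suc (k + k) choose Suc k = Suc (k + k) choose k"
    using binomial_symmetric[of "Suc k" "Suc (k + k)"] by simp
  then show ?thesis
    by (simp add: Suc)
qed simp

lemma nonzero_product_imp_form4:
  fixes A :: "'a::field poly mat"
  assumes char: "CHAR('a) = 2" and exp: "exponential_mat 4 A"
    and i: "i > 0" and j: "j > 0" and nz: "coeff_mat A i * coeff_mat A j \<noteq> 0\<^sub>m 4 4"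
  shows "\<exists>B \<in> form4 2. equivalent_mat 4 A B"
proof -
  \<comment> \<open>Stated for every \<open>C\<close>, since \<open>A\<close> needs it for the basis
    and \<open>B\<close> for its diagonal.\<close>
  have square_zero: "coeff_mat C l * coeff_mat C l = 0\<^sub>m 4 4"
    if C: "exponential_mat 4 C" and "l > 0" for l and C :: "'a poly mat"
  proof -
    have "of_nat ((l + l) choose l) = (0 :: 'a)"
      using even_central_binomial[OF \<open>l > 0\<close>] char by (simp only: of_nat_eq_0_iff_char_dvd)
    then show ?thesis
      using exponential_mat_coeff(1)[OF C]
      unfolding exponential_mat_coeff(3)[OF C] by (auto intro!: eq_matI)
  qed
  note A = exponential_mat_coeff(1)[OF exp]
  note cA = coeff_mat_carrier[OF A]
  obtain P Q where P: "P \<in> carrier_mat 4 4" and Q: "Q \<in> carrier_mat 4 4"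
    and QP: "Q * P = 1\<^sub>m 4" and PQ: "P * Q = 1\<^sub>m 4"
    and X: "Q * coeff_mat A i * P = nil_X" and Y: "Q * coeff_mat A j * P = nil_Y"
    using commuting_square_zero_basis[OF cA cA square_zero[OF exp i] square_zero[OF exp j]
        exponential_mat_coeff(4)[OF exp] nz] by blast
  define B where "B = map_mat (\<lambda>c. [:c:]) Q * A * map_mat (\<lambda>c. [:c:]) P"
  have exp_B: "exponential_mat 4 B"
    unfolding B_def by (rule exponential_mat_conj[OF A Q P QP PQ exp])
  note B = exponential_mat_coeff(1)[OF exp_B]
  have X: "coeff_mat B i = nil_X" and Y: "coeff_mat B j = nil_Y"
    using coeff_mat_conj[OF A Q P, folded B_def] X Y by simp_all
  have coeff_B: "coeff (B $$ (s, t)) l = coeff_mat B l $$ (s, t)" if "s < 4" "t < 4" for s t l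
    using that B by simp
  note shape = commute_nil_X_nil_Y[OF coeff_mat_carrier[OF B] exponential_mat_coeff(4)[OF exp_B, of _ i, unfolded X]
      exponential_mat_coeff(4)[OF exp_B, of _ j, unfolded Y]]
  \<comment> \<open>Each positive coefficient of \<open>B\<close> has zeros in its last row before
    the diagonal, and a constant diagonal. Its square is zero, hence so is the diagonal.\<close>
  have diag: "B $$ (0, 0) = 1"
  proof (rule poly_eqI)
    fix l
    show "coeff (B $$ (0, 0)) l = coeff 1 l"
    proof (cases "l = 0")
      case True
      then show ?thesis
        by (simp add: coeff_B exponential_mat_coeff(2)[OF exp_B])
    next
      case False
      let ?M = "coeff_mat B l"
      note M = coeff_mat_carrier[OF B, of l]
      have "(?M * ?M) $$ (3, 3) = ?M $$ (0, 0) * ?M $$ (0, 0)"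
        by (simp add: mat_mult_index[OF M M] lessThan_4 shape
            del: index_mult_mat(1) coeff_mat_index One_nat_def)
      then have "?M $$ (0, 0) = 0"
        using square_zero[OF exp_B, of l] False by simp
      then show ?thesis
        using False by (simp add: coeff_B coeff_eq_0 del: coeff_mat_index)
    qed
  qed
  \<comment> \<open>Commutation equates entry (1, 3) with b and entry (2, 3) with a, which forces
    \<open>\<mu>\<close> = 1; c is then the rest of the corner.\<close>
  define a b c where "a = B $$ (0, 1)" and "b = B $$ (0, 2)" and "c = B $$ (0, 3) - a * b"
  have rows: "B = mat_of_rows_list 4
      [[1, a, b, smult 1 (a * b) + c], [0, 1, 0, smult 1 b], [0, 0, 1, smult 1 a], [0, 0, 0, 1]]"
    by (rule mat_eq_rows_4[OF B])
      (auto simp: poly_eq_iff coeff_B shape a_def b_def c_def simp flip: diag simp del: coeff_mat_index One_nat_def)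
  have "p_polynomial 2 a" "p_polynomial 2 b" "p_polynomial 2 c"
    using exp_B rows exponential_form4_iff[of a b 1 c] additive_poly_iff_p_polynomial[OF _ char] by auto
  moreover have "lin_indep_pair a b"
    unfolding lin_indep_pair_def
  proof (intro allI impI)
    fix x y
    assume "smult x a + smult y b = 0"
    then have "x * coeff a l + y * coeff b l = 0" for l
      by (metis coeff_0 coeff_add coeff_smult)
    \<comment> \<open>The coefficients of (a, b) are (1, 0) at T^i and (0, 1) at T^j, as read off
      from \<open>nil_X\<close> and \<open>nil_Y\<close>.\<close>
    from this[of i] this[of j] show "x = 0 \<and> y = 0"
      by (simp add: a_def b_def coeff_B X Y nil_X_index nil_Y_index del: coeff_mat_index)
  qed
  ultimately have "B \<in> form4 2"
    unfolding form4_def using rows by blast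
  moreover have "equivalent_mat 4 A B"
    unfolding equivalent_mat_def B_def inverts_mat_def using P Q PQ QP by auto
  ultimately show ?thesis
    by blast
qed

section \<open>The classification in characteristic 2\<close>

theorem theorem4p3:
  assumes "CHAR('a::field) = 2"
  shows "(\<forall>B :: 'a poly mat. B \<in> form1 2 \<union> form2 2 \<union> form3 2 \<union> form4 2 \<longrightarrow> exponential_mat 4 B) \<and>
         (\<forall>A :: 'a poly mat. exponential_mat 4 A \<longrightarrow>
            (\<exists>B \<in> form1 2 \<union> form2 2 \<union> form3 2 \<union> form4 2. equivalent_mat 4 A B))"
proof (intro conjI allI impI)
  fix B :: "'a poly mat"
  assume "B \<in> form1 2 \<union> form2 2 \<union> form3 2 \<union> form4 2"
  then show "exponential_mat 4 B"
    by (auto simp: form1_def form2_def form3_def form4_def exponential_form1_iff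
        exponential_form2_iff exponential_form3_iff exponential_form4_iff
        additive_poly_iff_p_polynomial[OF two_is_prime_nat assms])
next
  fix A :: "'a poly mat"
  assume A: "exponential_mat 4 A"
  show "\<exists>B \<in> form1 2 \<union> form2 2 \<union> form3 2 \<union> form4 2. equivalent_mat 4 A B"
  proof (cases "\<forall>l>0. \<forall>m>0. coeff_mat A l * coeff_mat A m = 0\<^sub>m 4 4")
    case True
    then show ?thesis
      using products_zero_imp_form[OF two_is_prime_nat assms A] by blast
  next
    case False
    then show ?thesis
      using nonzero_product_imp_form4[OF assms A] by blast
  qed
qed

end
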